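(* Let $X$ be an infinite set of cardinality $\kappa$. If $\kappa$ is regular, then the maximal submonoids of $\mathcal{O}^{(1)}$ which contain all permutations of $X$ are exactly the monoid $\mathcal{A}$ and the monoids $\mathcal{G}_\lambda$ and $\mathcal{M}_\lambda$ for $\lambda=1$ and for cardinals $\aleph_0\le\lambda\le\kappa$, where $$\mathcal{A}=\{f\in\mathcal{O}^{(1)} : f^{-1}[y]\text{ is small for almost all } y\in X\},$$ $$\mathcal{G}_\lambda=\{f\in\mathcal{O}^{(1)} : \text{if } A\subseteq X \text{ has cardinality } \lambda \text{ then } |X\setminus f[X\setminus A]|\ge\lambda\},$$ $$\mathcal{M}_\lambda=\{f\in\mathcal{O}^{(1)} : f\text{ is }\lambda\text{-surjective or not }\lambda\text{-injective}\}.$$ If $\kappa$ is singular, then the same is true with the monoid $\mathcal{A}$ replaced by $$\mathcal{A}'=\{f\in\mathcal{O}^{(1)} : \exists\lambda<\kappa\ \big(|f^{-1}[\{x\}]|\le\lambda\text{ for almost all }x\in X\big)\}.$$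
   Context: $\mathcal{O}^{(1)}$ is the monoid of all functions $X\to X$ under composition. A submonoid of $\mathcal{O}^{(1)}$ is a subset containing the identity and closed under composition; a maximal submonoid is a dual atom of the lattice of submonoids of $\mathcal{O}^{(1)}$ ordered by inclusion. A subset of $X$ is small if its cardinality is less than $\kappa=|X|$. A property holds for almost all $y\in X$ if the set of $y$ for which it fails is small. For a cardinal $\lambda\le\kappa$, $f\in\mathcal{O}^{(1)}$ is $\lambda$-surjective if $|X\setminus f[X]|<\lambda$, and $\lambda$-injective if $|\{x\in X : \exists y\ne x\ (f(x)=f(y))\}|<\lambda$. *)

theory Defs
  imports Main "HOL-Algebra.Group"
begin

unbundle cardinal_syntax

text \<open>
  The base set \<open>X\<close> is the universe of the type \<^typ>\<open>'a\<close>, so that \<open>\<kappa>\<close> is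
  \<open>|UNIV :: 'a set|\<close>. A cardinal \<open>\<lambda>\<close> is given by a relation \<open>r\<close> with \<open>Card_order r\<close>.
  All notions below depend on \<open>r\<close> only up to \<open>=o\<close>, and every cardinal \<open>\<lambda> \<le> \<kappa>\<close> is isomorphic
  to some \<open>r :: 'a rel\<close>, so quantifying over \<^typ>\<open>'a rel\<close> covers exactly the cardinals
  \<open>\<le> \<kappa>\<close>.
\<close>

definition full_monoid :: "('a \<Rightarrow> 'a) monoid" where
  "full_monoid = \<lparr>carrier = UNIV, mult = (\<circ>), one = id\<rparr>"

text \<open>Dual atoms of the lattice of submonoids of \<open>G\<close>.\<close>

definition maximal_submonoid :: "'b set \<Rightarrow> ('b, 'c) monoid_scheme \<Rightarrow> bool" where
  "maximal_submonoid H G \<longleftrightarrow>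
     submonoid H G \<and> H \<noteq> carrier G \<and>
     (\<forall>K. submonoid K G \<and> H \<subseteq> K \<longrightarrow> K = H \<or> K = carrier G)"

definition small :: "'a set \<Rightarrow> bool" where
  "small A \<longleftrightarrow> |A| <o |UNIV :: 'a set|"

definition almost_all :: "('a \<Rightarrow> bool) \<Rightarrow> bool" where
  "almost_all P \<longleftrightarrow> small {y. \<not> P y}"

definition card_surjective :: "'b rel \<Rightarrow> ('a \<Rightarrow> 'a) \<Rightarrow> bool" where
  "card_surjective r f \<longleftrightarrow> |UNIV - range f| <o r"

definition card_injective :: "'b rel \<Rightarrow> ('a \<Rightarrow> 'a) \<Rightarrow> bool" where
  "card_injective r f \<longleftrightarrow> |{x. \<exists>y. y \<noteq> x \<and> f x = f y}| <o r"

definition A_monoid :: "('a \<Rightarrow> 'a) set" where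
  "A_monoid = {f. almost_all (\<lambda>y. small (f -` {y}))}"

definition A'_monoid :: "('a \<Rightarrow> 'a) set" where
  "A'_monoid = {f. \<exists>r :: 'a rel. Card_order r \<and> r <o |UNIV :: 'a set| \<and>
                     almost_all (\<lambda>x. |f -` {x}| \<le>o r)}"

definition G_monoid :: "'b rel \<Rightarrow> ('a \<Rightarrow> 'a) set" where
  "G_monoid r = {f. \<forall>A. |A| =o r \<longrightarrow> r \<le>o |UNIV - f ` (UNIV - A)|}"

definition M_monoid :: "'b rel \<Rightarrow> ('a \<Rightarrow> 'a) set" where
  "M_monoid r = {f. card_surjective r f \<or> \<not> card_injective r f}"

definition index_cardinals :: "'a rel set" where
  "index_cardinals =
     {r. Card_order r \<and> (r =o cone \<or> natLeq \<le>o r \<and> r \<le>o |UNIV :: 'a set| )}"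

end

theory Submission
  imports Defs
begin

text \<open>
  The listed monoids are proper, contain all permutations and are pairwise incomparable. So it
  suffices that a submonoid \<open>H\<close> of the monoid of all functions which contains all permutations and lies in none of
  them is everything. By induction on cardinals, \<open>\<not> H \<subseteq> M\<^sub>\<lambda>\<close> for all \<open>\<lambda>\<close> yields an injection in
  \<open>H\<close> with co-range of size \<open>\<kappa>\<close>, and \<open>\<not> H \<subseteq> G\<^sub>\<lambda>\<close> for all \<open>\<lambda>\<close> yields \<open>s \<in> H\<close> which remains
  surjective after removing \<open>\<kappa>\<close> points. Since permutations are available, all injections are then
  in \<open>H\<close>, and injections can be cancelled on the left: \<open>c \<circ> h \<in> H\<close> implies \<open>h \<in> H\<close>. Hence \<open>h \<in> H\<close>
  as soon as the fibres of \<open>h\<close> embed into distinct fibres of some \<open>f \<in> H\<close>.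
  For regular \<open>\<kappa>\<close>, any \<open>f \<in> H - A\<close> has \<open>\<kappa>\<close> fibres of size \<open>\<kappa>\<close>, which is enough for every \<open>h\<close>.
  For singular \<open>\<kappa>\<close>, \<open>f \<in> H - A'\<close> gives all \<open>h\<close> with small fibres; two of these compose to
  \<open>X \<times> X \<rightarrow> X \<times> K \<rightarrow> X\<close>, where \<open>K\<close> is a small cofinal set, and this composition has \<open>\<kappa>\<close> fibres
  of size \<open>\<kappa>\<close>.
\<close>

section \<open>Cardinalities of sets and permutations\<close>

lemma not_card_of_ordLeq: "\<not> |A| \<le>o |B| \<longleftrightarrow> |B| <o |A|"
  by (rule not_ordLeq_iff_ordLess[OF card_of_Well_order card_of_Well_order])

lemma not_card_of_ordLess: "\<not> |A| <o |B| \<longleftrightarrow> |B| \<le>o |A|"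
  by (rule not_ordLess_iff_ordLeq[OF card_of_Well_order card_of_Well_order])

lemma finite_card_of_ordLess: "finite A \<Longrightarrow> infinite B \<Longrightarrow> |A| <o |B|"
  by (rule finite_ordLess_infinite[OF card_of_Well_order card_of_Well_order]) (simp_all add: Field_card_of)

lemma ordIso_subset_obtains:
  assumes "|A| \<le>o |B|"
  obtains C where "C \<subseteq> B" "|C| =o |A|"
  using assms internalize_card_of_ordLeq2[of A B] ordIso_symmetric by blast

lemma inj_card_of_image: "inj_on f A \<Longrightarrow> |f ` A| =o |A|"
  using card_of_ordIso ordIso_symmetric by (metis bij_betw_def)

lemma ordIso_bij:
  assumes "|A| =o |B|"
  obtains f where "bij_betw f A B"
  using assms by (auto simp: card_of_ordIso[symmetric])

lemma bij_from_ordIso: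
  assumes "|C| =o |D|" "|- C| =o |- D|"
  obtains p where "bij p" "p ` C = D" "p ` (- C) = - D"
proof -
  obtain f g where f: "bij_betw f C D" and g: "bij_betw g (- C) (- D)"
    using ordIso_bij[OF assms(1)] ordIso_bij[OF assms(2)] by metis
  define p where "p = (\<lambda>x. if x \<in> C then f x else g x)"
  have p: "bij_betw p C D" "bij_betw p (- C) (- D)"
    using f g by (auto simp: p_def bij_betw_def inj_on_def)
  have "bij_betw p (C \<union> - C) (D \<union> - D)"
    by (rule bij_betw_combine[OF p]) auto
  then have "bij p" by simp
  with p that show thesis by (auto simp: bij_betw_def)
qed

text \<open>The map \<open>g\<close> after the inverse of \<open>f\<close> on \<open>range f\<close>
  and any bijection between the co-ranges glue to a permutation. So, up to a permutation on the
  left, an injection is determined by the cardinality of its co-range.\<close>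

lemma bij_extending:
  assumes f: "inj f" and g: "inj g" and r: "|- range f| =o |- range g|"
  obtains p where "bij p" "p \<circ> f = g"
proof -
  obtain h where h: "bij_betw h (- range f) (- range g)"
    using r by (rule ordIso_bij)
  define p where "p = (\<lambda>x. if x \<in> range f then g (inv_into UNIV f x) else h x)"
  have pf: "p (f x) = g x" for x using f by (simp add: p_def)
  have "bij_betw p (range f) (range g)"
    unfolding bij_betw_def
    by (auto simp: image_image pf inj_eq[OF g] intro!: inj_onI)
  moreover have "bij_betw p (- range f) (- range g)"
    using h by (subst bij_betw_cong[of _ _ h]) (auto simp: p_def)
  ultimately have "bij_betw p (range f \<union> - range f) (range g \<union> - range g)"
    by (rule bij_betw_combine) auto
  then have "bij p" by simp
  moreover have "p \<circ> f = g" by (simp add: fun_eq_iff pf)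
  ultimately show thesis by (rule that)
qed

section \<open>Small sets and their complements\<close>

lemma small_subset: "small B \<Longrightarrow> A \<subseteq> B \<Longrightarrow> small A"
  unfolding small_def using card_of_mono1 ordLeq_ordLess_trans by blast

lemma small_ordLeq: "small B \<Longrightarrow> |A| \<le>o |B| \<Longrightarrow> small A" for A B :: "'a set"
  unfolding small_def using ordLeq_ordLess_trans by blast

lemma small_image: "small A \<Longrightarrow> small (f ` A)" for A :: "'a set" and f :: "'a \<Rightarrow> 'a"
  using small_ordLeq card_of_image by blast

lemma not_small_iff: "\<not> small A \<longleftrightarrow> |A| =o |UNIV :: 'a set|" for A :: "'a set"
  unfolding small_def not_card_of_ordLess
  by (simp add: ordIso_iff_ordLeq card_of_mono1)

lemma not_small_UNIV: "\<not> small UNIV"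
  unfolding not_small_iff by (rule card_of_refl)

lemma not_small_ordIso:
  fixes A B :: "'a set"
  assumes "\<not> small A" "\<not> small B"
  shows "|A| =o |B|"
  using assms[unfolded not_small_iff] ordIso_transitive[OF _ ordIso_symmetric] by blast

lemma not_small_range: "inj f \<Longrightarrow> \<not> small (range f)" for f :: "'a \<Rightarrow> 'a"
  unfolding not_small_iff by (rule inj_card_of_image)

section \<open>Consequences of \<open>X\<close> being infinite: absorption and standard maps\<close>

context
  assumes infinite_UNIV: "infinite (UNIV :: 'a set)"
begin

lemma small_Un: "small A \<Longrightarrow> small B \<Longrightarrow> small (A \<union> B)" for A B :: "'a set"
  unfolding small_def using infinite_UNIV card_of_Un_ordLess_infinite by blast

lemma finite_small: "finite A \<Longrightarrow> small A" for A :: "'a set"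
  unfolding small_def using infinite_UNIV by (rule finite_card_of_ordLess[rotated])

lemma Compl_small: "small A \<Longrightarrow> \<not> small (- A)" for A :: "'a set"
  using small_Un[of A "- A"] not_small_UNIV by auto

lemma UNIV_square: "\<exists>b :: 'a \<times> 'a \<Rightarrow> 'a. bij b"
proof -
  have "|UNIV \<times> UNIV :: ('a \<times> 'a) set| =o |UNIV :: 'a set|"
    using infinite_UNIV by (rule card_of_Times_same_infinite)
  then show ?thesis by (auto simp: card_of_ordIso[symmetric])
qed

text \<open>Identify \<open>X\<close> with \<open>X\<close> times \<open>X\<close>: a copy of
  \<open>L\<close> is placed in the row of \<open>u\<close>, and the row of a different point
  \<open>v\<close> remains in the complement.\<close>

lemma subset_large_Compl:
  obtains C :: "'a set" where "|C| =o |L :: 'a set|" "\<not> small (- C)"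
proof -
  obtain b :: "'a \<times> 'a \<Rightarrow> 'a" where b: "bij b" using UNIV_square by blast
  obtain u v :: 'a where uv: "u \<noteq> v"
  proof (rule ccontr)
    assume "\<not> thesis"
    with that have "UNIV = {undefined :: 'a}" by blast
    then show False using infinite_UNIV by (metis finite.emptyI finite.insertI)
  qed
  define j where "j w x = b (w, x)" for w x
  have inj: "inj b" using b by (rule bij_is_inj)
  have j: "inj (j w)" for w
    by (auto simp: j_def inj_eq[OF inj] intro: injI)
  have "range (j v) \<subseteq> - (j u ` L)"
    using uv by (auto simp: j_def inj_eq[OF inj])
  then have "\<not> small (- (j u ` L))"
    using not_small_range[OF j] small_subset by blast
  moreover have "|j u ` L| =o |L|"
    by (rule inj_card_of_image) (rule inj_on_subset[OF j], simp)
  ultimately show thesis by (intro that)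
qed

text \<open>These injections are the standard functions outside \<open>M_monoid |L|\<close> when
  \<open>L\<close> is an index set.\<close>

lemma injection_corange:
  obtains e :: "'a \<Rightarrow> 'a" where "inj e" "|- range e| =o |L :: 'a set|"
proof -
  obtain C :: "'a set" where C: "|C| =o |L|" "\<not> small (- C)" by (rule subset_large_Compl)
  have "|UNIV :: 'a set| =o |- C|" using C(2) not_small_iff ordIso_symmetric by blast
  then obtain e where "bij_betw e (UNIV :: 'a set) (- C)" by (rule ordIso_bij)
  then have "inj e" "range e = - C" by (simp_all add: bij_betw_def)
  with C that[of e] show thesis by simp
qed

text \<open>Send \<open>- C\<close> bijectively onto \<open>X\<close> and fix \<open>C\<close>
  pointwise. The result is still onto after \<open>C\<close> is removed, which puts it outside
  \<open>G_monoid |L|\<close> for an index set \<open>L\<close>, while its fibres have at most two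
  points.\<close>

lemma surjection_omitting:
  obtains q :: "'a \<Rightarrow> 'a" and C
  where "|C| =o |L :: 'a set|" "q ` (- C) = UNIV" "inj_on q (- C)" "inj_on q C"
proof -
  obtain C :: "'a set" where C: "|C| =o |L|" "\<not> small (- C)" by (rule subset_large_Compl)
  have "|- C| =o |UNIV :: 'a set|" using C(2) not_small_iff by blast
  then obtain e where e: "bij_betw e (- C) (UNIV :: 'a set)" by (rule ordIso_bij)
  define q where "q x = (if x \<in> C then x else e x)" for x
  show thesis
    using e C by (intro that[of C q]) (auto simp: q_def bij_betw_def inj_on_def image_iff)
qed

text \<open>This is the first projection of \<open>X\<close> times \<open>X\<close>, transported to
  \<open>X\<close>.\<close>

lemma surjection_large_fibres:
  obtains f :: "'a \<Rightarrow> 'a" where "surj f" "\<And>y. \<not> small (f -` {y})"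
proof -
  obtain b :: "'a \<times> 'a \<Rightarrow> 'a" where b: "bij b" using UNIV_square by blast
  define f where "f x = fst (inv_into UNIV b x)" for x
  have fb: "f (b (x, y)) = x" for x y
    using b by (simp add: f_def bij_is_inj)
  have "surj f" by (rule surjI[of f "\<lambda>x. b (x, undefined)"]) (simp add: fb)
  moreover have "\<not> small (f -` {y})" for y
  proof -
    have "inj (\<lambda>x. b (y, x))"
      by (auto simp: inj_eq[OF bij_is_inj[OF b]] intro: injI)
    moreover have "range (\<lambda>x. b (y, x)) \<subseteq> f -` {y}" using fb by auto
    ultimately show ?thesis using not_small_range small_subset by blast
  qed
  ultimately show thesis using that by blast
qed

end

section \<open>The monoids \<open>G_monoid\<close> and \<open>M_monoid\<close>\<close>

text \<open>The identity is covered by the second conjunct, since it is a permutation.\<close>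

definition permutation_monoid :: "('a \<Rightarrow> 'a) set \<Rightarrow> bool" where
  "permutation_monoid H \<longleftrightarrow> (\<forall>f\<in>H. \<forall>g\<in>H. f \<circ> g \<in> H) \<and> {f. bij f} \<subseteq> H"

lemma permutation_monoid_iff:
  "permutation_monoid H \<longleftrightarrow> submonoid H full_monoid \<and> {f. bij f} \<subseteq> H"
  by (auto simp: permutation_monoid_def full_monoid_def submonoid_def)

lemma permutation_monoidI:
  assumes "\<And>f g. f \<in> H \<Longrightarrow> g \<in> H \<Longrightarrow> f \<circ> g \<in> H" "\<And>f. bij f \<Longrightarrow> f \<in> H"
  shows "permutation_monoid H"
  using assms by (auto simp: permutation_monoid_def)

lemma comp_mem: "permutation_monoid H \<Longrightarrow> f \<in> H \<Longrightarrow> g \<in> H \<Longrightarrow> f \<circ> g \<in> H"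
  and bij_mem: "permutation_monoid H \<Longrightarrow> bij f \<Longrightarrow> f \<in> H"
  by (auto simp: permutation_monoid_def)

text \<open>Replaces the relations indexing the monoids by their fields.\<close>

definition index_set :: "'a set \<Rightarrow> bool" where
  "index_set L \<longleftrightarrow> is_singleton L \<or> infinite L"

lemma G_monoid_cong:
  assumes "r =o r'"
  shows "G_monoid r = G_monoid r'"
proof -
  have "|A| =o r \<longleftrightarrow> |A| =o r'" "r \<le>o |A| \<longleftrightarrow> r' \<le>o |A|" for A :: "'c set"
    using assms ordIso_transitive ordIso_symmetric ordIso_ordLeq_trans by meson+
  then show ?thesis unfolding G_monoid_def by simp
qed

lemma M_monoid_cong:
  assumes "r =o r'"
  shows "M_monoid r = M_monoid r'"
proof -
  have "|A| <o r \<longleftrightarrow> |A| <o r'" for A :: "'c set"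
    using assms ordLess_ordIso_trans ordIso_symmetric by meson
  then show ?thesis unfolding M_monoid_def card_surjective_def card_injective_def by simp
qed

lemma singleton_ordIso_cone: "|{a}| =o cone"
  unfolding cone_def by (auto intro: card_of_ordIsoI[of "\<lambda>_. ()"] simp: bij_betw_def)

lemma index_cardinals_Field:
  assumes "r \<in> index_cardinals"
  shows "index_set (Field r) \<and> r =o |Field r|"
proof -
  have r: "Card_order r" "r =o cone \<or> natLeq \<le>o r"
    using assms by (auto simp: index_cardinals_def)
  then have F: "r =o |Field r|" using card_of_Field_ordIso ordIso_symmetric by blast
  from r(2) have "index_set (Field r)"
  proof
    assume "r =o cone"
    then have "|Field r| =o |{()}|"
      using F ordIso_transitive ordIso_symmetric unfolding cone_def by blast
    then obtain f where "bij_betw f (Field r) {()}" by (rule ordIso_bij)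
    then show ?thesis
      by (auto dest!: bij_betw_same_card simp: index_set_def is_singleton_altdef)
  next
    assume "natLeq \<le>o r"
    then have "natLeq \<le>o |Field r|" using F ordLeq_ordIso_trans by blast
    then show ?thesis using infinite_iff_natLeq_ordLeq by (auto simp: index_set_def)
  qed
  with F show ?thesis by blast
qed

lemma index_set_cardinals:
  assumes "index_set L"
  shows "|L| \<in> index_cardinals"
  using assms singleton_ordIso_cone infinite_iff_natLeq_ordLeq
  by (auto simp: index_set_def index_cardinals_def is_singleton_def card_of_Card_order card_of_mono1)

lemma index_families:
  "{G_monoid r | r. r \<in> (index_cardinals :: 'a rel set)} = {G_monoid |L| :: ('a \<Rightarrow> 'a) set | L :: 'a set. index_set L}"
  "{M_monoid r | r. r \<in> (index_cardinals :: 'a rel set)} = {M_monoid |L| :: ('a \<Rightarrow> 'a) set | L :: 'a set. index_set L}"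
proof -
  have *: "{F r | r. r \<in> (index_cardinals :: 'a rel set)} = {F |L| | L :: 'a set. index_set L}"
    if "\<And>r r'. r =o r' \<Longrightarrow> F r = F r'" for F :: "'a rel \<Rightarrow> ('a \<Rightarrow> 'a) set"
  proof (safe, goal_cases)
    case (1 _ r)
    then show ?case using index_cardinals_Field[of r] that[of r "|Field r|"] by blast
  next
    case (2 _ L)
    then show ?case using index_set_cardinals[of L] by blast
  qed
  show "{G_monoid r | r. r \<in> (index_cardinals :: 'a rel set)} = {G_monoid |L| :: ('a \<Rightarrow> 'a) set | L :: 'a set. index_set L}"
    by (rule *) (rule G_monoid_cong)
  show "{M_monoid r | r. r \<in> (index_cardinals :: 'a rel set)} = {M_monoid |L| :: ('a \<Rightarrow> 'a) set | L :: 'a set. index_set L}"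
    by (rule *) (rule M_monoid_cong)
qed

text \<open>The only finite index is 1, and no index lies below it because index sets are
  nonempty.\<close>

lemma index_set_less:
  assumes "index_set K" "index_set L" "|K| <o |L|"
  shows "infinite L"
proof
  assume "finite L"
  with assms(2) obtain a where L: "L = {a}" by (auto simp: index_set_def is_singleton_def)
  have "K \<noteq> {}" using assms(1) by (auto simp: index_set_def is_singleton_def)
  then have "|{a}| \<le>o |K|" by (rule card_of_singl_ordLeq)
  with assms(3) L show False using not_card_of_ordLeq by blast
qed

lemma ordLess_singleton_iff: "|A| <o |{a}| \<longleftrightarrow> A = {}"
proof -
  have "|{a}| \<le>o |A| \<longleftrightarrow> A \<noteq> {}"
    using card_of_singl_ordLeq[of A a] card_of_empty3[of "{a}"] by auto
  then show ?thesis by (simp add: not_card_of_ordLeq[symmetric])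
qed

lemma index_set_empty: "index_set L \<Longrightarrow> |{}| <o |L|"
  by (metis card_of_empty3 finite.emptyI index_set_def is_singleton_def insert_not_empty not_card_of_ordLeq)

lemma index_set_Un:
  assumes "index_set L" "|A| <o |L|" "|B| <o |L|"
  shows "|A \<union> B| <o |L|"
proof (cases "infinite L")
  case True
  then show ?thesis using assms card_of_Un_ordLess_infinite by blast
next
  case False
  then obtain a where "L = {a}" using assms(1) by (auto simp: index_set_def is_singleton_def)
  then show ?thesis using assms by (simp add: ordLess_singleton_iff)
qed

lemma mem_G_monoid:
  "f \<in> G_monoid |L| \<longleftrightarrow> (\<forall>A. |A| =o |L| \<longrightarrow> |L| \<le>o |- f ` (- A)| )"
  by (simp add: G_monoid_def Compl_eq_Diff_UNIV)

lemma mem_M_monoid: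
  "f \<in> M_monoid |L| \<longleftrightarrow> |- range f| <o |L| \<or> |L| \<le>o |{x. \<exists>y. y \<noteq> x \<and> f x = f y}|"
  by (simp add: M_monoid_def card_surjective_def card_injective_def Compl_eq_Diff_UNIV
      not_card_of_ordLess)

lemma not_mem_G_monoid:
  "f \<notin> G_monoid |L| \<longleftrightarrow> (\<exists>A. |A| =o |L| \<and> |- f ` (- A)| <o |L| )"
  using not_card_of_ordLeq[of L] by (auto simp: mem_G_monoid)

lemma not_mem_M_monoid:
  "f \<notin> M_monoid |L| \<longleftrightarrow> |L| \<le>o |- range f| \<and> |{x. \<exists>y. y \<noteq> x \<and> f x = f y}| <o |L|"
  by (simp add: mem_M_monoid not_card_of_ordLeq not_card_of_ordLess)

text \<open>The points that \<open>g\<close> misses on \<open>- A\<close> include a set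
  \<open>B\<close> of size \<open>|L|\<close>. Then \<open>f \<circ> g\<close> maps
  \<open>- A\<close> into the image of \<open>- B\<close> under \<open>f\<close>, which already
  misses \<open>|L|\<close> points.\<close>

lemma permutation_monoid_G:
  fixes L :: "'b set"
  shows "permutation_monoid (G_monoid |L| :: ('a \<Rightarrow> 'a) set)"
proof (rule permutation_monoidI)
  fix f g :: "'a \<Rightarrow> 'a"
  assume f: "f \<in> G_monoid |L|" and g: "g \<in> G_monoid |L|"
  show "f \<circ> g \<in> G_monoid |L|"
    unfolding mem_G_monoid
  proof (intro allI impI)
    fix A :: "'a set"
    assume "|A| =o |L|"
    with g have "|L| \<le>o |- g ` (- A)|" by (simp add: mem_G_monoid)
    then obtain B where B: "B \<subseteq> - g ` (- A)" "|B| =o |L|" by (rule ordIso_subset_obtains)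
    with f have "|L| \<le>o |- f ` (- B)|" by (simp add: mem_G_monoid)
    also have "|- f ` (- B)| \<le>o |- (f \<circ> g) ` (- A)|"
      using B(1) by (intro card_of_mono1) auto
    finally (ordLeq_transitive) show "|L| \<le>o |- (f \<circ> g) ` (- A)|" .
  qed
next
  fix f :: "'a \<Rightarrow> 'a"
  assume f: "bij f"
  have "|L| \<le>o |- f ` (- A)|" if "|A| =o |L|" for A
  proof -
    have "- f ` (- A) = f ` A"
      using f by (simp add: bij_image_Compl_eq)
    moreover have "|f ` A| =o |A|"
      by (rule inj_card_of_image) (rule inj_on_subset[OF bij_is_inj[OF f]], simp)
    ultimately have "|- f ` (- A)| =o |L|"
      using that ordIso_transitive by metis
    then show ?thesis by (simp add: ordIso_iff_ordLeq)
  qed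
  then show "f \<in> G_monoid |L|" by (simp add: mem_G_monoid)
qed

text \<open>Collisions of \<open>g\<close> survive in \<open>f \<circ> g\<close>, so
  \<open>g\<close> may be assumed to miss fewer than \<open>|L|\<close> points. Then the co-range of
  \<open>f \<circ> g\<close> is small relative to \<open>L\<close> if that of \<open>f\<close> is,
  and otherwise most collisions of \<open>f\<close> are seen inside \<open>range g\<close>.\<close>

lemma permutation_monoid_M:
  fixes L :: "'b set"
  assumes L: "index_set L"
  shows "permutation_monoid (M_monoid |L| :: ('a \<Rightarrow> 'a) set)"
proof (rule permutation_monoidI)
  fix f g :: "'a \<Rightarrow> 'a"
  define N where "N h = {x. \<exists>y. y \<noteq> x \<and> h x = h y}" for h :: "'a \<Rightarrow> 'a"
  have mem: "h \<in> M_monoid |L| \<longleftrightarrow> |- range h| <o |L| \<or> |L| \<le>o |N h|" for h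
    unfolding N_def by (rule mem_M_monoid)
  assume f: "f \<in> M_monoid |L|" and g: "g \<in> M_monoid |L|"
  show "f \<circ> g \<in> M_monoid |L|"
  proof (cases "|L| \<le>o |N g|")
    case True
    moreover have "|N g| \<le>o |N (f \<circ> g)|"
      by (rule card_of_mono1) (force simp: N_def)
    ultimately have "|L| \<le>o |N (f \<circ> g)|" by (rule ordLeq_transitive)
    then show ?thesis by (simp only: mem simp_thms)
  next
    case False
    with g have g': "|- range g| <o |L|" by (simp add: mem)
    from f consider "|- range f| <o |L|" | "|L| \<le>o |N f|" by (auto simp: mem)
    then show ?thesis
    proof cases
      case 1
      have "- range (f \<circ> g) \<subseteq> - range f \<union> f ` (- range g)" by auto
      then have "|- range (f \<circ> g)| <o |L|"
        by (rule ordLeq_ordLess_trans[OF card_of_mono1])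
          (rule index_set_Un[OF L 1 ordLeq_ordLess_trans[OF card_of_image g']])
      then show ?thesis by (simp only: mem simp_thms)
    next
      case 2
      \<comment> \<open>The collisions of \<open>f\<close> that are lost in
        \<open>f \<circ> g\<close>: points of \<open>range g\<close> all of whose partners lie
        outside it. Two points of \<open>Z\<close> with a common partner have the same value under
        \<open>f\<close>, hence coincide, so \<open>Z\<close> embeds into
        \<open>- range g\<close>.\<close>
      define Z where "Z = {x \<in> N f. x \<in> range g \<and> (\<forall>y. y \<noteq> x \<and> f x = f y \<longrightarrow> y \<notin> range g)}"
      have "\<forall>x\<in>Z. \<exists>y. y \<noteq> x \<and> f x = f y \<and> y \<notin> range g" by (auto simp: Z_def N_def)
      then obtain k where k: "\<And>x. x \<in> Z \<Longrightarrow> k x \<noteq> x \<and> f x = f (k x) \<and> k x \<notin> range g"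
        by metis
      have "inj_on k Z"
      proof (rule inj_onI)
        fix x y
        assume xy: "x \<in> Z" "y \<in> Z" "k x = k y"
        then have "f x = f y" using k by metis
        with xy show "x = y" by (auto simp: Z_def)
      qed
      moreover have "k ` Z \<subseteq> - range g" using k by auto
      ultimately have "|Z| \<le>o |- range g|" using card_of_ordLeq[of Z "- range g"] by blast
      then have Z: "|Z| <o |L|" using g' by (rule ordLeq_ordLess_trans)
      have "N f \<subseteq> (g ` N (f \<circ> g) \<union> - range g) \<union> Z"
        by (force simp: N_def Z_def)
      then have "|L| \<le>o |(g ` N (f \<circ> g) \<union> - range g) \<union> Z|"
        by (rule ordLeq_transitive[OF 2 card_of_mono1])
      then have "\<not> |(g ` N (f \<circ> g) \<union> - range g) \<union> Z| <o |L|"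
        by (simp only: not_card_of_ordLess)
      then have "\<not> |g ` N (f \<circ> g)| <o |L|"
        using index_set_Un[OF L index_set_Un[OF L _ g'] Z] by blast
      then have "\<not> |N (f \<circ> g)| <o |L|"
        using ordLeq_ordLess_trans[OF card_of_image] by blast
      then show ?thesis by (simp only: mem not_card_of_ordLess simp_thms)
    qed
  qed
next
  fix f :: "'a \<Rightarrow> 'a"
  assume "bij f"
  then have "- range f = {}" by (simp add: bij_is_surj)
  then show "f \<in> M_monoid |L|" by (simp add: mem_M_monoid index_set_empty[OF L])
qed

lemma corange_mem_G: "|L| \<le>o |- range f| \<Longrightarrow> f \<in> G_monoid |L|"
  unfolding mem_G_monoid
  by (intro allI impI) (erule ordLeq_transitive, rule card_of_mono1, blast)

lemma surj_mem_M: "index_set L \<Longrightarrow> surj f \<Longrightarrow> f \<in> M_monoid |L|"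
  by (simp add: mem_M_monoid index_set_empty)

lemma inj_mem_M_iff:
  assumes "index_set L" "inj f"
  shows "f \<in> M_monoid |L| \<longleftrightarrow> |- range f| <o |L|"
proof -
  have N: "{x. \<exists>y. y \<noteq> x \<and> f x = f y} = {}" using assms(2) by (auto dest: injD)
  show ?thesis
    using index_set_empty[OF assms(1)] unfolding mem_M_monoid N
    by (auto simp: not_card_of_ordLess[symmetric])
qed

lemma omitting_not_mem_G:
  assumes "index_set L" "|C| =o |L|" "q ` (- C) = UNIV"
  shows "q \<notin> G_monoid |L|"
  using assms index_set_empty[OF assms(1)] by (auto simp: not_mem_G_monoid)

text \<open>Ignoring the fewer than \<open>|L|\<close> points of \<open>C\<close>, the map is
  injective, so removing \<open>|L|\<close> points of the domain loses \<open>|L|\<close>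
  values.\<close>

lemma omitting_mem_G:
  fixes q :: "'a \<Rightarrow> 'a" and L :: "'b set"
  assumes L: "infinite L" and C: "|C| <o |L|" and inj: "inj_on q (- C)"
  shows "q \<in> G_monoid |L|"
  unfolding mem_G_monoid
proof (intro allI impI)
  fix A :: "'a set"
  assume A: "|A| =o |L|"
  \<comment> \<open>A value taken on \<open>A - C\<close> can be taken again on \<open>- A\<close>
    only at a point of \<open>C\<close>, by injectivity off \<open>C\<close>.\<close>
  have "q ` (A - C) - q ` C \<subseteq> - q ` (- A)"
    using inj by (force simp: inj_on_def)
  then have le: "|q ` (A - C) - q ` C| \<le>o |- q ` (- A)|" by (rule card_of_mono1)
  \<comment> \<open>In contrapositive form: discarding fewer than \<open>|L|\<close> points from a
    set of at least \<open>|L|\<close> points leaves at least \<open>|L|\<close>.\<close>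
  have less: "|B| <o |L|" if "|B - D| <o |L|" "|D| <o |L|" for B D :: "'a set"
    by (rule ordLeq_ordLess_trans[OF card_of_mono1 card_of_Un_ordLess_infinite[OF L that]]) blast
  have "\<not> |A| <o |L|" using A not_ordLess_ordIso by blast
  then have "\<not> |A - C| <o |L|" using less C by blast
  moreover have "|q ` (A - C)| =o |A - C|"
    by (rule inj_card_of_image) (rule inj_on_subset[OF inj], auto)
  ultimately have "\<not> |q ` (A - C)| <o |L|"
    using ordIso_ordLess_trans[OF ordIso_symmetric] by blast
  then have "\<not> |q ` (A - C) - q ` C| <o |L|"
    using less[OF _ ordLeq_ordLess_trans[OF card_of_image C]] by blast
  then have "|L| \<le>o |q ` (A - C) - q ` C|" by (simp only: not_card_of_ordLess)
  then show "|L| \<le>o |- q ` (- A)|" using le by (rule ordLeq_transitive)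
qed

section \<open>Incomparability of the monoids \<open>G_monoid\<close> and
  \<open>M_monoid\<close>\<close>

context
  assumes infinite_UNIV: "infinite (UNIV :: 'a set)"
begin

lemma M_not_subset_G:
  assumes "index_set (K :: 'a set)" "index_set (L :: 'a set)"
  shows "\<not> (M_monoid |L| :: ('a \<Rightarrow> 'a) set) \<subseteq> G_monoid |K|"
proof -
  obtain q :: "'a \<Rightarrow> 'a" and C where "|C| =o |K|" "q ` (- C) = UNIV"
    by (rule surjection_omitting[OF infinite_UNIV, of K])
  then have "q \<notin> G_monoid |K|" "surj q"
    using assms omitting_not_mem_G by blast+
  then show ?thesis using surj_mem_M[OF assms(2)] by blast
qed

lemma G_not_subset_M:
  assumes "index_set (K :: 'a set)" "index_set (L :: 'a set)"
  shows "\<not> (G_monoid |L| :: ('a \<Rightarrow> 'a) set) \<subseteq> M_monoid |K|"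
proof -
  obtain e :: "'a \<Rightarrow> 'a" where e: "inj e" "|- range e| =o |UNIV :: 'a set|"
    by (rule injection_corange[OF infinite_UNIV, of UNIV])
  have le: "|B| \<le>o |- range e|" for B :: "'a set"
    using ordLeq_ordIso_trans[OF card_of_mono1[OF subset_UNIV] ordIso_symmetric[OF e(2)]] .
  then have "e \<in> G_monoid |L|" by (intro corange_mem_G)
  moreover have "e \<notin> M_monoid |K|"
    using le e assms(1) by (simp add: inj_mem_M_iff not_card_of_ordLess)
  ultimately show ?thesis by blast
qed

text \<open>If \<open>K\<close> is smaller, an injection with co-range of size \<open>|K|\<close>
  separates the monoids. If \<open>L\<close> is smaller, follow a surjection having at least
  \<open>|L|\<close> but fewer than \<open>|K|\<close> collisions by that injection.\<close>

lemma M_subset_imp_ordIso: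
  assumes K: "index_set (K :: 'a set)" and L: "index_set (L :: 'a set)"
    and sub: "(M_monoid |L| :: ('a \<Rightarrow> 'a) set) \<subseteq> M_monoid |K|"
  shows "|L| =o |K|"
proof (rule ccontr)
  obtain e :: "'a \<Rightarrow> 'a" where e: "inj e" "|- range e| =o |K|"
    by (rule injection_corange[OF infinite_UNIV, of K])
  assume "\<not> |L| =o |K|"
  then consider "|K| <o |L|" | "|L| <o |K|"
    by (metis not_card_of_ordLeq ordIso_iff_ordLeq)
  then show False
  proof cases
    case 1
    have "|- range e| <o |L|" using e(2) 1 by (rule ordIso_ordLess_trans)
    then have "e \<in> M_monoid |K|" using inj_mem_M_iff[OF L e(1)] sub by blast
    then have "|- range e| <o |K|" by (simp only: inj_mem_M_iff[OF K e(1)])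
    then show False using e(2) not_ordLess_ordIso by blast
  next
    case 2
    then have inf: "infinite K" using K L index_set_less by blast
    obtain q :: "'a \<Rightarrow> 'a" and C where q: "|C| =o |L|" "q ` (- C) = UNIV"
        "inj_on q (- C)" "inj_on q C"
      by (rule surjection_omitting[OF infinite_UNIV, of L])
    define N where "N = {x. \<exists>y. y \<noteq> x \<and> (e \<circ> q) x = (e \<circ> q) y}"
    have N: "N = {x. \<exists>y. y \<noteq> x \<and> q x = q y}" using e(1) by (auto simp: N_def inj_eq)
    have "C \<subseteq> N"
    proof
      fix x assume x: "x \<in> C"
      obtain y where "y \<notin> C" "q x = q y" using q(2) by (metis ComplD UNIV_I imageE)
      with x show "x \<in> N" by (auto simp: N)
    qed
    then have "|L| \<le>o |N|"
      by (rule ordIso_ordLeq_trans[OF ordIso_symmetric[OF q(1)] card_of_mono1])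
    then have mem: "e \<circ> q \<in> M_monoid |L|" by (simp add: mem_M_monoid N_def)
    \<comment> \<open>A point of \<open>N\<close> outside \<open>C\<close> shares its value with a
      point of \<open>C\<close>, because \<open>q\<close> is injective on \<open>- C\<close>. So
      \<open>N\<close> is at most twice as large as \<open>C\<close>.\<close>
    have le: "|N - C| \<le>o |C|"
    proof -
      have "inj_on q (N - C)" by (rule inj_on_subset[OF q(3)]) auto
      moreover have "q ` (N - C) \<subseteq> q ` C"
        using q(3) by (force simp: N inj_on_def)
      ultimately have "|N - C| \<le>o |q ` C|" using card_of_ordLeq[of "N - C" "q ` C"] by blast
      then show ?thesis using card_of_image by (rule ordLeq_transitive)
    qed
    have C: "|C| <o |K|" using q(1) 2 by (rule ordIso_ordLess_trans)
    have "|N| <o |K|"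
      by (rule ordLeq_ordLess_trans[OF card_of_mono1 index_set_Un[OF K C ordLeq_ordLess_trans[OF le C]]]) blast
    moreover have "surj q" using q(2) by blast
    then have "range (e \<circ> q) = range e" by (simp only: image_comp[symmetric])
    moreover have "|K| \<le>o |- range e|" using e(2) by (simp add: ordIso_iff_ordLeq)
    ultimately have "e \<circ> q \<notin> M_monoid |K|"
      unfolding not_mem_M_monoid N_def by simp
    with mem sub show False by blast
  qed
qed

text \<open>If \<open>K\<close> is smaller, the surjection omitting \<open>|K|\<close> points
  separates the monoids. If \<open>L\<close> is smaller, follow it by an injection that misses
  \<open>|L|\<close> points: that is enough loss for \<open>L\<close> and too little for
  \<open>K\<close>.\<close>

lemma G_subset_imp_ordIso:
  assumes K: "index_set (K :: 'a set)" and L: "index_set (L :: 'a set)"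
    and sub: "(G_monoid |L| :: ('a \<Rightarrow> 'a) set) \<subseteq> G_monoid |K|"
  shows "|L| =o |K|"
proof (rule ccontr)
  obtain q :: "'a \<Rightarrow> 'a" and C where q: "|C| =o |K|" "q ` (- C) = UNIV" "inj_on q (- C)"
    by (rule surjection_omitting[OF infinite_UNIV, of K])
  assume "\<not> |L| =o |K|"
  then consider "|K| <o |L|" | "|L| <o |K|"
    by (metis not_card_of_ordLeq ordIso_iff_ordLeq)
  then show False
  proof cases
    case 1
    then have "infinite L" using K L index_set_less by blast
    moreover have "|C| <o |L|" using q(1) 1 by (rule ordIso_ordLess_trans)
    ultimately have "q \<in> G_monoid |L|" using q(3) by (rule omitting_mem_G)
    then show False using sub omitting_not_mem_G[OF K q(1,2)] by blast
  next
    case 2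
    obtain e :: "'a \<Rightarrow> 'a" where e: "inj e" "|- range e| =o |L|"
      by (rule injection_corange[OF infinite_UNIV, of L])
    have r: "(e \<circ> q) ` (- C) = range e" using q(2) by (simp only: image_comp[symmetric])
    have "range (e \<circ> q) = range e" using r by auto
    moreover have "|L| \<le>o |- range e|" using e(2) by (simp add: ordIso_iff_ordLeq)
    ultimately have "e \<circ> q \<in> G_monoid |L|" by (intro corange_mem_G) simp
    moreover have "|- (e \<circ> q) ` (- C)| <o |K|"
      unfolding r using e(2) 2 by (rule ordIso_ordLess_trans)
    then have "e \<circ> q \<notin> G_monoid |K|" using q(1) by (auto simp only: not_mem_G_monoid)
    ultimately show False using sub by blast
  qed
qed

end

section \<open>Monoids contained in none of the \<open>G_monoid r\<close> and \<open>M_monoid r\<close>\<close>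

lemma inj_iff_no_collision: "inj f \<longleftrightarrow> {x. \<exists>y. y \<noteq> x \<and> f x = f y} = {}"
  unfolding inj_def by (simp add: set_eq_iff) metis

lemma finite_insert_ordLess:
  assumes "finite T" "x \<notin> T"
  shows "|T| <o |insert x T|"
proof (rule ccontr)
  assume "\<not> ?thesis"
  then have "|insert x T| \<le>o |T|" by (simp only: not_card_of_ordLess)
  then obtain f where "inj_on f (insert x T)" "f ` insert x T \<subseteq> T"
    by (auto simp only: card_of_ordLeq[symmetric])
  then have "card (insert x T) \<le> card T" using assms(1) by (rule card_inj_on_le)
  then show False using assms by simp
qed

lemma small_underS: "small (underS |UNIV :: 'a set| x)" for x :: 'a
  unfolding small_def by (rule card_of_underS[OF card_of_Card_order]) (simp add: Field_card_of)

text \<open>Transfinite recursion along a well-order of \<open>X\<close> of type \<kappa>: at each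
  stage only a small set of values has been used, so \<open>Y x\<close> still offers a new
  one.\<close>

lemma inj_choice:
  fixes Y :: "'a \<Rightarrow> 'a set"
  assumes Y: "\<And>x. \<not> small (Y x)"
  obtains c where "inj c" "\<And>x. c x \<in> Y x"
proof -
  let ?r = "|UNIV :: 'a set|"
  have wo: "well_order_on UNIV ?r" by (rule card_of_well_order_on)
  then have wf: "wf (?r - Id)" and lin: "linear_order_on UNIV ?r"
    by (simp_all add: well_order_on_def)
  define c where "c = wfrec (?r - Id) (\<lambda>c x. SOME y. y \<in> Y x \<and> y \<notin> c ` underS ?r x)"
  \<comment> \<open>The recursion reads earlier values only, so the cut made by \<open>wfrec\<close>
    does not change them.\<close>
  have eq: "cut c (?r - Id) x ` underS ?r x = c ` underS ?r x" for x
    by (rule image_cong) (auto simp: cut_def underS_def)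
  have rec: "c x = (SOME y. y \<in> Y x \<and> y \<notin> c ` underS ?r x)" for x
    unfolding c_def by (subst wfrec[OF wf]) (simp only: eq[unfolded c_def])
  have c: "c x \<in> Y x \<and> c x \<notin> c ` underS ?r x" for x
  proof -
    have "small (underS ?r x)"
      by (rule small_underS)
    then have "small (c ` underS ?r x)" by (rule small_image)
    then have "\<exists>y. y \<in> Y x \<and> y \<notin> c ` underS ?r x" using Y[of x] small_subset by blast
    then show ?thesis unfolding rec[of x] by (rule someI_ex)
  qed
  have less: "c x \<noteq> c y" if "(x, y) \<in> ?r" "x \<noteq> y" for x y
  proof -
    have "x \<in> underS ?r y" using that by (simp add: underS_def)
    then show ?thesis using c[of y] by (metis imageI)
  qed
  have "inj c"
  proof (rule injI, rule ccontr)
    fix x y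
    assume "c x = c y" "x \<noteq> y"
    moreover from this have "(x, y) \<in> ?r \<or> (y, x) \<in> ?r"
      using lin by (auto simp: linear_order_on_def total_on_def)
    ultimately show False using less by metis
  qed
  with c that show thesis by blast
qed

section \<open>Injections and surjections forced into \<open>H\<close>, and criteria for membership
  in \<open>H\<close>\<close>

context
  fixes H :: "('a \<Rightarrow> 'a) set"
  assumes infinite_UNIV: "infinite (UNIV :: 'a set)"
    and H: "permutation_monoid H"
    and not_M: "\<And>L :: 'a set. index_set L \<Longrightarrow> \<not> H \<subseteq> M_monoid |L|"
    and not_G: "\<And>L :: 'a set. index_set L \<Longrightarrow> \<not> H \<subseteq> G_monoid |L|"
begin

lemma wf_card_of: "wf (inv_image ordLess (card_of :: 'a set \<Rightarrow> 'a rel))"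
  by (rule wf_inv_image[OF wf_ordLess])

lemma small_less: "|B| <o |S| \<Longrightarrow> small B" for B S :: "'a set"
  unfolding small_def by (erule ordLess_ordLeq_trans) (rule card_of_mono1[OF subset_UNIV])

text \<open>Induction on the cardinality of \<open>S\<close>. For infinite \<open>S\<close> a
  function outside \<open>M_monoid |S|\<close> is made injective by the induction hypothesis; a
  finite \<open>S\<close> is treated by adding one point at a time.\<close>

lemma injection_avoiding:
  "\<not> small (- S) \<Longrightarrow> \<exists>i\<in>H. inj i \<and> range i \<inter> S = {}"
proof (induction S rule: wf_induct_rule[OF wf_card_of])
  case (1 S)
  \<comment> \<open>A set of smaller cardinality than \<open>S\<close> is small, so its complement
    is automatically large.\<close>
  have IH: "\<exists>i\<in>H. inj i \<and> range i \<inter> T = {}" if "|T| <o |S|" for T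
    using 1(1)[of T] that Compl_small[OF infinite_UNIV small_less[OF that]] by simp
  show ?case
  proof (cases "finite S")
    case False
    then obtain m where m: "m \<in> H" "m \<notin> M_monoid |S|"
      using not_M[of S] by (auto simp: index_set_def)
    \<comment> \<open>The collision set \<open>N\<close> is smaller than \<open>S\<close>, so some
      injection in \<open>H\<close> avoids it. Composing \<open>m\<close> with that injection gives
      an injection which still misses \<open>|S|\<close> points, and a permutation moves these onto
      \<open>S\<close>.\<close>
    define N where "N = {x. \<exists>y. y \<noteq> x \<and> m x = m y}"
    have mS: "|S| \<le>o |- range m|" "|N| <o |S|"
      using m(2) by (simp_all add: not_mem_M_monoid N_def)
    obtain i where i: "i \<in> H" "inj i" "range i \<inter> N = {}" using IH[OF mS(2)] by blast
    have inj: "inj (m \<circ> i)"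
    proof (rule injI)
      fix x y
      assume "(m \<circ> i) x = (m \<circ> i) y"
      moreover have "i x \<notin> N" using i(3) by blast
      ultimately have "i x = i y" unfolding N_def by (simp, metis)
      then show "x = y" using i(2) by (simp add: inj_eq)
    qed
    obtain C where C: "C \<subseteq> - range m" "|C| =o |S|" using mS(1) by (rule ordIso_subset_obtains)
    have "range (m \<circ> i) \<subseteq> - C" using C(1) by auto
    then have "\<not> small (- C)" using not_small_range[OF inj] small_subset by blast
    then have "|- C| =o |- S|" using 1(2) by (rule not_small_ordIso)
    with C(2) obtain p where p: "bij p" "p ` C = S" "p ` (- C) = - S"
      by (rule bij_from_ordIso)
    have "p \<circ> (m \<circ> i) \<in> H" using m(1) i(1) by (intro comp_mem[OF H] bij_mem[OF H p(1)])
    moreover have "inj (p \<circ> (m \<circ> i))" using bij_is_inj[OF p(1)] inj by (rule inj_compose)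
    moreover have "range (p \<circ> (m \<circ> i)) \<subseteq> - S" using p(3) C(1) by fastforce
    ultimately show ?thesis by blast
  next
    case fin: True
    show ?thesis
    proof (cases "S = {}")
      case True
      have "id \<in> H" using H bij_id by (rule bij_mem)
      with True show ?thesis by (intro bexI[of _ id]) simp_all
    next
      case False
      then obtain x T where S: "S = insert x T" "x \<notin> T" by (meson all_not_in_conv mk_disjoint_insert)
      have "|T| <o |S|" unfolding S(1)
        using fin S by (intro finite_insert_ordLess) simp_all
      then obtain i where i: "i \<in> H" "inj i" "range i \<inter> T = {}" using IH by blast
      show ?thesis
      proof (cases "x \<in> range i")
        case False
        with i S show ?thesis by blast
      next
        case True
        then obtain a where a: "x = i a" by blast
        obtain m where m: "m \<in> H" "m \<notin> M_monoid |{x}|"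
          using not_M[of "{x}"] by (auto simp: index_set_def)
        have "|{x}| \<le>o |- range m|" and N: "{x. \<exists>y. y \<noteq> x \<and> m x = m y} = {}"
          using m(2) unfolding not_mem_M_monoid ordLess_singleton_iff by blast+
        then have "\<not> |- range m| <o |{x}|" by (simp only: not_card_of_ordLess)
        then obtain b where b: "b \<notin> range m" unfolding ordLess_singleton_iff by blast
        have inj_m: "inj m" using N by (simp only: inj_iff_no_collision)
        have large: "\<not> small (- {y})" for y :: 'a
          by (intro Compl_small[OF infinite_UNIV] finite_small[OF infinite_UNIV]) simp
        \<comment> \<open>The permutation moves the point \<open>b\<close> missed by
          \<open>m\<close> to the unique preimage \<open>a\<close> of \<open>x\<close> under
          \<open>i\<close>, so that the composition misses \<open>x\<close> too.\<close>
        have "|{b}| =o |{a}|" by (intro card_of_ordIsoI[of "\<lambda>_. a"]) (simp add: bij_betw_def)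
        then obtain p where p: "bij p" "p ` {b} = {a}" "p ` (- {b}) = - {a}"
          using not_small_ordIso[OF large large] by (rule bij_from_ordIso)
        have "a \<notin> range (p \<circ> m)" using p(3) b by fastforce
        then have "x \<notin> range (i \<circ> (p \<circ> m))" using a i(2) by (auto simp: inj_eq)
        moreover have "range (i \<circ> (p \<circ> m)) \<inter> T = {}" using i(3) by auto
        moreover have "i \<circ> (p \<circ> m) \<in> H" using m(1) i(1) by (intro comp_mem[OF H] bij_mem[OF H p(1)])
        moreover have "inj (i \<circ> (p \<circ> m))"
          using i(2) bij_is_inj[OF p(1)] inj_m by (intro inj_compose)
        ultimately show ?thesis unfolding S(1) by blast
      qed
    qed
  qed
qed

text \<open>Dual to the construction of injections: a function outside \<open>G_monoid |S|\<close>
  loses fewer than \<open>|S|\<close> values when \<open>|S|\<close> points are removed, and the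
  induction hypothesis applied to the lost values restores surjectivity.\<close>

lemma surjection_from_Compl:
  "\<not> small (- S) \<Longrightarrow> \<exists>s\<in>H. s ` (- S) = UNIV"
proof (induction S rule: wf_induct_rule[OF wf_card_of])
  case (1 S)
  have IH: "\<exists>s\<in>H. s ` (- T) = UNIV" if "|T| <o |S|" for T
    using 1(1)[of T] that Compl_small[OF infinite_UNIV small_less[OF that]] by simp
  show ?case
  proof (cases "finite S")
    case False
    then obtain g where g: "g \<in> H" "g \<notin> G_monoid |S|"
      using not_G[of S] by (auto simp: index_set_def)
    then obtain A where A: "|A| =o |S|" "|- g ` (- A)| <o |S|" by (auto simp: not_mem_G_monoid)
    obtain s where s: "s \<in> H" "s ` g ` (- A) = UNIV" using IH[OF A(2)] by auto
    \<comment> \<open>Since \<open>- A\<close> is mapped onto \<open>X\<close>, it is large, and a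
      permutation can exchange \<open>S\<close> for \<open>A\<close>.\<close>
    have "\<not> small (s ` g ` (- A))" using not_small_UNIV by (simp add: s(2))
    then have "\<not> small (- A)" using small_image by blast
    then have "|- S| =o |- A|" using 1(2) not_small_ordIso by blast
    with ordIso_symmetric[OF A(1)] obtain p where p: "bij p" "p ` S = A" "p ` (- S) = - A"
      by (rule bij_from_ordIso)
    have "s \<circ> (g \<circ> p) \<in> H" using g(1) s(1) by (intro comp_mem[OF H] bij_mem[OF H p(1)])
    moreover have "(s \<circ> (g \<circ> p)) ` (- S) = UNIV"
      by (simp only: image_comp[symmetric] p(3) s(2))
    ultimately show ?thesis by blast
  next
    case fin: True
    show ?thesis
    proof (cases "S = {}")
      case True
      have "id \<in> H" using H bij_id by (rule bij_mem)
      with True show ?thesis by (intro bexI[of _ id]) simp_all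
    next
      case False
      then obtain x T where S: "S = insert x T" "x \<notin> T" by (meson all_not_in_conv mk_disjoint_insert)
      have "|T| <o |S|" unfolding S(1)
        using fin S by (intro finite_insert_ordLess) simp_all
      then obtain s where s: "s \<in> H" "s ` (- T) = UNIV" using IH by blast
      obtain g where g: "g \<in> H" "g \<notin> G_monoid |{x}|"
        using not_G[of "{x}"] by (auto simp: index_set_def)
      then obtain A where A: "|A| =o |{x}|" "g ` (- A) = UNIV"
        by (auto simp: not_mem_G_monoid ordLess_singleton_iff)
      obtain f where "bij_betw f {x} A" using ordIso_symmetric[OF A(1)] by (rule ordIso_bij)
      then have fx: "A = {f x}" by (auto simp: bij_betw_def)
      have large: "\<not> small (- {y})" for y :: 'a
        by (intro Compl_small[OF infinite_UNIV] finite_small[OF infinite_UNIV]) simp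
      have "|{s x}| =o |{f x}|" by (intro card_of_ordIsoI[of "\<lambda>_. f x"]) (simp add: bij_betw_def)
      then obtain p where p: "bij p" "p ` {s x} = {f x}" "p ` (- {s x}) = - {f x}"
        using not_small_ordIso[OF large large] by (rule bij_from_ordIso)
      \<comment> \<open>Removing the further point \<open>x\<close> costs \<open>s\<close> at most
        the value \<open>s x\<close>. The permutation moves this value to \<open>f x\<close>, the
        point without which \<open>g\<close> is still onto.\<close>
      have "- {s x} \<subseteq> s ` (- S)"
      proof
        fix y
        assume y: "y \<in> - {s x}"
        obtain z where z: "z \<in> - T" "y = s z" using s(2) by blast
        with y show "y \<in> s ` (- S)" by (auto simp: S(1))
      qed
      then have "g ` p ` (- {s x}) \<subseteq> (g \<circ> (p \<circ> s)) ` (- S)"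
        unfolding image_comp[symmetric] by (intro image_mono)
      then have "(g \<circ> (p \<circ> s)) ` (- S) = UNIV" using A(2) fx p(3) by auto
      moreover have "g \<circ> (p \<circ> s) \<in> H" using g(1) s(1) by (intro comp_mem[OF H] bij_mem[OF H p(1)])
      ultimately show ?thesis by blast
    qed
  qed
qed

text \<open>Any two injections with large co-range differ by a permutation, and a right inverse
  of the surjection below has large co-range.\<close>

lemma retraction:
  obtains s j t where "s \<in> H" "j \<in> H" "inj j" "\<not> small (- range j)"
    "s \<circ> t = id" "\<not> small (- range t)"
proof -
  obtain A :: "'a set" where A: "|A| =o |UNIV :: 'a set|" "\<not> small (- A)"
    by (rule subset_large_Compl[OF infinite_UNIV])
  have A': "\<not> small A" using A(1) by (simp add: not_small_iff)
  obtain j where j: "j \<in> H" "inj j" "range j \<inter> A = {}"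
    using injection_avoiding[OF A(2)] by blast
  obtain s where s: "s \<in> H" "s ` (- A) = UNIV"
    using surjection_from_Compl[OF A(2)] by blast
  have "\<forall>x. \<exists>y. y \<in> - A \<and> s y = x" using s(2) by (metis UNIV_I imageE)
  then obtain t where t: "\<And>x. t x \<in> - A \<and> s (t x) = x" by metis
  have "A \<subseteq> - range j" "A \<subseteq> - range t" using j(3) t by auto
  then have "\<not> small (- range j)" "\<not> small (- range t)" using A' small_subset by blast+
  moreover have "s \<circ> t = id" using t by auto
  ultimately show thesis using that s(1) j(1,2) by blast
qed

text \<open>The injections \<open>j \<circ> c\<close> and \<open>t\<close> both have co-range of
  size \<kappa>, so \<open>p \<circ> (j \<circ> c) = t\<close> for a permutation \<open>p\<close>.
  Hence \<open>s \<circ> (p \<circ> j)\<close> is a left inverse of \<open>c\<close> lying in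
  \<open>H\<close>.\<close>

lemma left_factor_mem:
  assumes c: "inj c" and ch: "c \<circ> h \<in> H"
  shows "h \<in> H"
proof -
  obtain s j t where s: "s \<in> H" "j \<in> H" "inj j" "\<not> small (- range j)"
    "s \<circ> t = id" "\<not> small (- range t)" by (rule retraction)
  have st: "s (t x) = x" for x using fun_cong[OF s(5), of x] by simp
  have "inj t" by (rule inj_on_inverseI[of _ s]) (rule st)
  moreover have jc: "inj (j \<circ> c)" using s(3) c by (rule inj_compose)
  moreover have "\<not> small (- range (j \<circ> c))" using s(4) by (rule contrapos_nn) (erule small_subset, auto)
  then have "|- range (j \<circ> c)| =o |- range t|" using s(6) by (rule not_small_ordIso)
  ultimately obtain p where p: "bij p" "p \<circ> (j \<circ> c) = t" using bij_extending by blast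
  have "h = s \<circ> (p \<circ> (j \<circ> (c \<circ> h)))"
    using st p(2) by (simp add: fun_eq_iff)
  then show ?thesis using H s p(1) ch by (metis comp_mem bij_mem)
qed

text \<open>The injection \<open>t \<circ> e\<close> has co-range of size \<kappa>, so it is
  \<open>p \<circ> j\<close> for a permutation \<open>p\<close>; applying \<open>s\<close> recovers
  \<open>e\<close>.\<close>

lemma inj_mem:
  assumes e: "inj e"
  shows "e \<in> H"
proof -
  obtain s j t where s: "s \<in> H" "j \<in> H" "inj j" "\<not> small (- range j)"
    "s \<circ> t = id" "\<not> small (- range t)" by (rule retraction)
  have st: "s (t x) = x" for x using fun_cong[OF s(5), of x] by simp
  have "inj t" by (rule inj_on_inverseI[of _ s]) (rule st)
  then have te: "inj (t \<circ> e)" using e by (rule inj_compose)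
  have "\<not> small (- range (t \<circ> e))" using s(6) by (rule contrapos_nn) (erule small_subset, auto)
  with s(4) have "|- range j| =o |- range (t \<circ> e)|" by (rule not_small_ordIso)
  with s(3) te obtain p where p: "bij p" "p \<circ> j = t \<circ> e" by (rule bij_extending)
  have "e = s \<circ> (p \<circ> j)" unfolding p(2) using st by (simp add: fun_eq_iff)
  then show ?thesis using H s p(1) by (metis comp_mem bij_mem)
qed

text \<open>Each fibre of \<open>h\<close> is assigned its own fibre of \<open>f\<close> into which
  it embeds. The embeddings glue to an injection \<open>i\<close> with
  \<open>f \<circ> i = c \<circ> h\<close>, and \<open>c\<close> is cancelled.\<close>

lemma fibre_bound_mem:
  assumes f: "f \<in> H" and large: "\<And>x. \<not> small {y. |h -` {x}| \<le>o |f -` {y}|}"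
  shows "h \<in> H"
proof -
  obtain c where c: "inj c" "\<And>x. c x \<in> {y. |h -` {x}| \<le>o |f -` {y}|}"
    using inj_choice[of "\<lambda>x. {y. |h -` {x}| \<le>o |f -` {y}|}", OF large] by metis
  have "\<exists>d. inj_on d (h -` {x}) \<and> d ` (h -` {x}) \<subseteq> f -` {c x}" for x
    using c(2)[of x] by (simp only: card_of_ordLeq mem_Collect_eq)
  then obtain d where d: "\<And>x. inj_on (d x) (h -` {x})" "\<And>x. d x ` (h -` {x}) \<subseteq> f -` {c x}"
    by metis
  define i where "i z = d (h z) z" for z
  have fi: "f (i z) = c (h z)" for z using d(2)[of "h z"] by (auto simp: i_def)
  have "inj i"
  proof (rule injI)
    fix z w
    assume zw: "i z = i w"
    then have "c (h z) = c (h w)" using fi by metis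
    then have hw: "h w = h z" using c(1) by (simp add: inj_eq)
    with zw have "d (h z) z = d (h z) w" by (simp add: i_def)
    then show "z = w" using d(1)[of "h z"] hw by (auto dest: inj_onD)
  qed
  then have "f \<circ> i \<in> H" by (intro comp_mem[OF H f] inj_mem)
  moreover have "f \<circ> i = c \<circ> h" using fi by auto
  ultimately show ?thesis using c(1) left_factor_mem by simp
qed

lemma large_fibres_imp_full:
  assumes "f \<in> H" "\<not> small {y. \<not> small (f -` {y})}"
  shows "H = UNIV"
proof -
  have "h \<in> H" for h
  proof (rule fibre_bound_mem[OF assms(1)])
    fix x
    have "|h -` {x}| \<le>o |f -` {y}|" if "\<not> small (f -` {y})" for y
    proof -
      have "|UNIV :: 'a set| =o |f -` {y}|" using that not_small_iff ordIso_symmetric by blast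
      with card_of_mono1[OF subset_UNIV] show ?thesis by (rule ordLeq_ordIso_trans)
    qed
    then have "{y. \<not> small (f -` {y})} \<subseteq> {y. |h -` {x}| \<le>o |f -` {y}|}" by blast
    then show "\<not> small {y. |h -` {x}| \<le>o |f -` {y}|}" using assms(2) small_subset by blast
  qed
  then show ?thesis by blast
qed

text \<open>First \<open>H\<close> receives every function with small fibres. Two of these collapse
  each row of \<open>X\<close> times \<open>X\<close> to a point: one sends the second coordinate
  into a small cofinal set, the other collapses that set.\<close>

lemma singular_imp_full:
  assumes sing: "\<not> regularCard |UNIV :: 'a set|"
    and f: "f \<in> H" "\<And>S :: 'a set. small S \<Longrightarrow> \<not> small {y. \<not> |f -` {y}| \<le>o |S|}"
  shows "H = UNIV"
proof -
  have mem: "h \<in> H" if "\<And>x. small (h -` {x})" for h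
  proof (rule fibre_bound_mem[OF f(1)])
    fix x
    have "{y. \<not> |f -` {y}| \<le>o |h -` {x}|} \<subseteq> {y. |h -` {x}| \<le>o |f -` {y}|}"
      by (auto simp only: not_card_of_ordLeq intro: ordLess_imp_ordLeq)
    then show "\<not> small {y. |h -` {x}| \<le>o |f -` {y}|}"
      using f(2)[OF that[of x]] small_subset by blast
  qed
  let ?r = "|UNIV :: 'a set|"
  obtain K where K: "cofinal K ?r" "\<not> |K| =o ?r"
    using sing by (auto simp: regularCard_def)
  have small_K: "small K" using K(2) not_small_iff by blast
  have "\<forall>y. \<exists>k\<in>K. y \<in> underS ?r k"
    using K(1) by (auto simp: cofinal_def underS_def Field_card_of)
  \<comment> \<open>The map \<open>idx\<close> sends \<open>y\<close> to an element of
    \<open>K\<close> strictly above it, so its fibres lie in proper initial segments and are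
    small.\<close>
  then obtain idx where idx: "\<And>y. idx y \<in> K" "\<And>y. y \<in> underS ?r (idx y)" by metis
  obtain b :: "'a \<times> 'a \<Rightarrow> 'a" where b: "bij b" using UNIV_square[OF infinite_UNIV] by blast
  have inj: "inj b" using b by (rule bij_is_inj)
  note b_eq = inj_eq[OF inj]
  have b_cases: "\<exists>x y. z = b (x, y)" for z using bij_is_surj[OF b] by (metis surjD surj_pair)
  define fst' snd' where "fst' z = fst (inv_into UNIV b z)" "snd' z = snd (inv_into UNIV b z)" for z
  have fs: "fst' (b (x, y)) = x" "snd' (b (x, y)) = y" for x y
    using inj by (simp_all add: fst'_snd'_def)
  define f1 where "f1 z = b (fst' z, idx (snd' z))" for z
  \<comment> \<open>Collapsing only the pairs with second coordinate in \<open>K\<close>, and fixing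
    all others, adds at most one point to the \<open>|K|\<close> collapsed points of a fibre. Here
    \<open>undefined\<close> is just a fixed element of \<open>X\<close>.\<close>
  define f2 where "f2 z = (if snd' z \<in> K then b (fst' z, undefined) else z)" for z
  have "small (f1 -` {z})" for z
  proof -
    obtain x k where z: "z = b (x, k)" using b_cases by blast
    have "f1 -` {z} \<subseteq> (\<lambda>y. b (x, y)) ` underS ?r k"
    proof
      fix w
      assume w: "w \<in> f1 -` {z}"
      obtain x' y' where w': "w = b (x', y')" using b_cases by blast
      have "x' = x" "idx y' = k" using w by (simp_all add: w' z f1_def fs b_eq)
      then show "w \<in> (\<lambda>y. b (x, y)) ` underS ?r k" using idx(2)[of y'] w' by blast
    qed
    moreover have "small (underS ?r k)"
      by (rule small_underS)
    ultimately show ?thesis using small_image small_subset by blast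
  qed
  then have f1: "f1 \<in> H" by (rule mem)
  have "small (f2 -` {z})" for z
  proof -
    obtain x k where z: "z = b (x, k)" using b_cases by blast
    have "f2 -` {z} \<subseteq> {z} \<union> (\<lambda>y. b (x, y)) ` K"
    proof
      fix w
      assume w: "w \<in> f2 -` {z}"
      obtain x' y' where w': "w = b (x', y')" using b_cases by blast
      show "w \<in> {z} \<union> (\<lambda>y. b (x, y)) ` K"
        using w by (auto simp: w' z f2_def fs b_eq split: if_splits)
    qed
    moreover have "small ({z} \<union> (\<lambda>y. b (x, y)) ` K)"
      by (intro small_Un finite_small infinite_UNIV small_image small_K) simp
    ultimately show ?thesis using small_subset by blast
  qed
  then have f2: "f2 \<in> H" by (rule mem)
  define u where "u x = b (x, undefined)" for x
  have f21: "(f2 \<circ> f1) (b (x, y)) = u x" for x y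
    using idx(1) by (simp add: f1_def f2_def fs u_def)
  have "\<not> small ((f2 \<circ> f1) -` {u x})" for x
  proof -
    have "range (\<lambda>y. b (x, y)) \<subseteq> (f2 \<circ> f1) -` {u x}" using f21 by auto
    moreover have "inj (\<lambda>y. b (x, y))" by (auto simp: b_eq intro: injI)
    ultimately show ?thesis using not_small_range small_subset by blast
  qed
  then have "range u \<subseteq> {y. \<not> small ((f2 \<circ> f1) -` {y})}" by auto
  moreover have "inj u" by (auto simp: b_eq u_def intro: injI)
  ultimately have "\<not> small {y. \<not> small ((f2 \<circ> f1) -` {y})}"
    using not_small_range small_subset by blast
  then show ?thesis using H f1 f2 by (intro large_fibres_imp_full[of "f2 \<circ> f1"] comp_mem)
qed

end

section \<open>The monoids \<open>A_monoid\<close> and \<open>A'_monoid\<close>, and the classification\<close>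

text \<open>The product embeds into the square of \<open>S \<union> T\<close>, which is finite or as
  large as \<open>S \<union> T\<close>. The copy \<open>W\<close> inside \<open>X\<close> serves as
  the fibre bound for a composition in \<open>A'_monoid\<close>.\<close>

lemma small_Times:
  fixes S T :: "'a set"
  assumes inf: "infinite (UNIV :: 'a set)" and S: "small S" and T: "small T"
  obtains W :: "'a set" where "small W" "|W| =o |S \<times> T|"
proof -
  let ?U = "S \<union> T"
  have U: "|?U| <o |UNIV :: 'a set|"
    using small_Un[OF inf S T] by (simp add: small_def)
  have "|?U \<times> ?U| <o |UNIV :: 'a set|"
  proof (cases "finite ?U")
    case True
    then have "finite (?U \<times> ?U)" by simp
    then show ?thesis using inf by (rule finite_card_of_ordLess)
  next
    case False
    then show ?thesis by (rule ordIso_ordLess_trans[OF card_of_Times_same_infinite U])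
  qed
  moreover have "|S \<times> T| \<le>o |?U \<times> ?U|" by (rule card_of_mono1) auto
  ultimately have less: "|S \<times> T| <o |UNIV :: 'a set|" by (rule ordLeq_ordLess_trans[rotated])
  obtain W :: "'a set" where W: "|W| =o |S \<times> T|"
    by (rule ordIso_subset_obtains[OF ordLess_imp_ordLeq[OF less]])
  have "small W" unfolding small_def by (rule ordIso_ordLess_trans[OF W less])
  with W that show thesis by blast
qed

text \<open>The cardinals below \<kappa> are those of small sets, so the bound can be given by a
  set; one passes to the field of the relation.\<close>

lemma mem_A'_monoid: "f \<in> A'_monoid \<longleftrightarrow> (\<exists>S :: 'a set. small S \<and> small {y. \<not> |f -` {y}| \<le>o |S|})"
  for f :: "'a \<Rightarrow> 'a"
proof
  assume "f \<in> A'_monoid"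
  then obtain r :: "'a rel" where r: "Card_order r" "r <o |UNIV :: 'a set|" "small {y. \<not> |f -` {y}| \<le>o r}"
    by (auto simp: A'_monoid_def almost_all_def)
  have F: "|Field r| =o r" using r(1) by (rule card_of_Field_ordIso)
  have "small (Field r)" unfolding small_def using F r(2) by (rule ordIso_ordLess_trans)
  moreover have "{y. \<not> |f -` {y}| \<le>o |Field r|} \<subseteq> {y. \<not> |f -` {y}| \<le>o r}"
    using ordLeq_ordIso_trans[OF _ ordIso_symmetric[OF F]] by blast
  ultimately show "\<exists>S :: 'a set. small S \<and> small {y. \<not> |f -` {y}| \<le>o |S|}"
    using r(3) small_subset by blast
next
  assume "\<exists>S :: 'a set. small S \<and> small {y. \<not> |f -` {y}| \<le>o |S|}"
  then show "f \<in> A'_monoid"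
    unfolding A'_monoid_def almost_all_def small_def using card_of_Card_order by blast
qed

lemma mem_A_monoid: "f \<in> A_monoid \<longleftrightarrow> small {y. \<not> small (f -` {y})}"
  by (simp add: A_monoid_def almost_all_def)

lemma bij_fibre: "bij f \<Longrightarrow> \<exists>x. f -` {y} = {x}"
  by (rule exI[of _ "inv_into UNIV f y"]) (auto simp: bij_is_inj bij_is_surj surj_f_inv_f)

section \<open>Closure of \<open>A_monoid\<close> and \<open>A'_monoid\<close>, and the common
  maximality argument\<close>

context
  assumes infinite_UNIV: "infinite (UNIV :: 'a set)"
begin

text \<open>Outside \<open>B f\<close> and the image of \<open>B g\<close> under \<open>f\<close>, a
  fibre of \<open>f \<circ> g\<close> is a union of a small family of small fibres. Regularity, in
  the form of stability, makes this union small.\<close>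

lemma permutation_monoid_A:
  assumes reg: "regularCard |UNIV :: 'a set|"
  shows "permutation_monoid (A_monoid :: ('a \<Rightarrow> 'a) set)"
proof (rule permutation_monoidI)
  fix f g :: "'a \<Rightarrow> 'a"
  define B where "B h = {y. \<not> small (h -` {y})}" for h :: "'a \<Rightarrow> 'a"
  assume "f \<in> A_monoid" "g \<in> A_monoid"
  then have fg: "small (B f)" "small (B g)" by (simp_all add: mem_A_monoid B_def)
  have stable: "stable |UNIV :: 'a set|"
    using infinite_UNIV reg by (intro regularCard_stable card_of_Card_order) (simp_all add: Field_card_of)
  have "B (f \<circ> g) \<subseteq> B f \<union> f ` B g"
  proof
    fix y
    assume y: "y \<in> B (f \<circ> g)"
    show "y \<in> B f \<union> f ` B g"
    proof (rule ccontr)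
      assume not: "y \<notin> B f \<union> f ` B g"
      have "small (\<Union>z\<in>f -` {y}. g -` {z})"
        unfolding small_def
        by (rule stable_UNION[OF stable]) (use not in \<open>auto simp: B_def small_def[symmetric]\<close>)
      moreover have "(f \<circ> g) -` {y} = (\<Union>z\<in>f -` {y}. g -` {z})" by auto
      ultimately show False using y by (simp add: B_def)
    qed
  qed
  moreover have "small (B f \<union> f ` B g)"
    using fg by (intro small_Un[OF infinite_UNIV] small_image)
  ultimately have "small (B (f \<circ> g))" using small_subset by blast
  then show "f \<circ> g \<in> A_monoid" by (simp add: mem_A_monoid B_def)
next
  fix f :: "'a \<Rightarrow> 'a"
  assume "bij f"
  then have "small (f -` {y})" for y
    using bij_fibre[of f y] finite_small[OF infinite_UNIV] by auto
  then show "f \<in> A_monoid" using finite_small[OF infinite_UNIV, of "{}"] by (simp add: mem_A_monoid)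
qed

lemma bounded_fibres_mem_A':
  "small (S :: 'a set) \<Longrightarrow> (\<And>y. |f -` {y}| \<le>o |S| ) \<Longrightarrow> f \<in> A'_monoid" for f :: "'a \<Rightarrow> 'a"
  using finite_small[OF infinite_UNIV, of "{}"] unfolding mem_A'_monoid by (intro exI[of _ S]) simp

text \<open>With uniform bounds \<open>|S|\<close> and \<open>|T|\<close> a fibre of
  \<open>f \<circ> g\<close> is bounded by the product outside a small exceptional set, so this
  argument works without regularity.\<close>

lemma permutation_monoid_A':
  "permutation_monoid (A'_monoid :: ('a \<Rightarrow> 'a) set)"
proof (rule permutation_monoidI)
  fix f g :: "'a \<Rightarrow> 'a"
  assume "f \<in> A'_monoid" "g \<in> A'_monoid"
  then obtain S T :: "'a set" where S: "small S" "small {y. \<not> |f -` {y}| \<le>o |S|}"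
    and T: "small T" "small {y. \<not> |g -` {y}| \<le>o |T|}" unfolding mem_A'_monoid by blast
  obtain W :: "'a set" where W: "small W" "|W| =o |S \<times> T|"
    by (rule small_Times[OF infinite_UNIV S(1) T(1)])
  have "{y. \<not> |(f \<circ> g) -` {y}| \<le>o |W|} \<subseteq> {y. \<not> |f -` {y}| \<le>o |S|} \<union> f ` {y. \<not> |g -` {y}| \<le>o |T|}"
  proof
    fix y
    assume y: "y \<in> {y. \<not> |(f \<circ> g) -` {y}| \<le>o |W|}"
    show "y \<in> {y. \<not> |f -` {y}| \<le>o |S|} \<union> f ` {y. \<not> |g -` {y}| \<le>o |T|}"
    proof (rule ccontr)
      assume not: "y \<notin> {y. \<not> |f -` {y}| \<le>o |S|} \<union> f ` {y. \<not> |g -` {y}| \<le>o |T|}"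
      then have f: "|f -` {y}| \<le>o |S|" and g: "\<forall>z\<in>f -` {y}. |g -` {z}| \<le>o |T|" by auto
      have "|\<Union>z\<in>f -` {y}. g -` {z}| \<le>o |SIGMA z : f -` {y}. g -` {z}|"
        by (rule card_of_UNION_Sigma)
      also have "|SIGMA z : f -` {y}. g -` {z}| \<le>o |f -` {y} \<times> T|"
        using g by (rule card_of_Sigma_mono1)
      also have "|f -` {y} \<times> T| \<le>o |S \<times> T|" using f by (rule card_of_Times_mono1)
      also have "|S \<times> T| =o |W|" using W(2) by (rule ordIso_symmetric)
      finally have "|\<Union>z\<in>f -` {y}. g -` {z}| \<le>o |W|" .
      moreover have "(f \<circ> g) -` {y} = (\<Union>z\<in>f -` {y}. g -` {z})" by auto
      ultimately show False using y by simp
    qed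
  qed
  moreover have "small ({y. \<not> |f -` {y}| \<le>o |S|} \<union> f ` {y. \<not> |g -` {y}| \<le>o |T|})"
    using S T by (intro small_Un[OF infinite_UNIV] small_image)
  ultimately show "f \<circ> g \<in> A'_monoid" unfolding mem_A'_monoid using W(1) small_subset by blast
next
  fix f :: "'a \<Rightarrow> 'a"
  assume f: "bij f"
  have "|f -` {y}| \<le>o |{undefined :: 'a}|" for y
  proof -
    obtain x where "f -` {y} = {x}" using bij_fibre[OF f] by blast
    then show ?thesis by (simp add: card_of_singl_ordLeq)
  qed
  then show "f \<in> A'_monoid"
    using finite_small[OF infinite_UNIV, of "{undefined}"] by (intro bounded_fibres_mem_A') simp_all
qed

text \<open>The interaction of \<open>A_monoid\<close> (for regular cardinality) and of \<open>A'_monoid\<close> (for singular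
  cardinality) with the other monoids only depends on the assumptions on \<open>N\<close> below.\<close>

lemma maximal_permutation_monoids:
  fixes N :: "('a \<Rightarrow> 'a) set"
  assumes N: "permutation_monoid N"
    and bounded: "\<And>f (S :: 'a set). small S \<Longrightarrow> (\<And>y. |f -` {y}| \<le>o |S| ) \<Longrightarrow> f \<in> N"
    and large: "\<And>f. \<not> small {y. \<not> small (f -` {y})} \<Longrightarrow> f \<notin> N"
    and cover: "\<And>H. permutation_monoid H \<Longrightarrow> (\<And>L :: 'a set. index_set L \<Longrightarrow> \<not> H \<subseteq> M_monoid |L| ) \<Longrightarrow>
      (\<And>L :: 'a set. index_set L \<Longrightarrow> \<not> H \<subseteq> G_monoid |L| ) \<Longrightarrow> \<not> H \<subseteq> N \<Longrightarrow> H = UNIV"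
  shows "{H. maximal_submonoid H (full_monoid :: ('a \<Rightarrow> 'a) monoid) \<and> {f. bij f} \<subseteq> H} =
    {N} \<union> {G_monoid r | r. r \<in> (index_cardinals :: 'a rel set)}
        \<union> {M_monoid r | r. r \<in> (index_cardinals :: 'a rel set)}"
    (is "_ = ?F")
proof -
  obtain u v :: 'a where uv: "u \<noteq> v" using infinite_UNIV
    by (metis (full_types) UNIV_eq_I finite.emptyI finite.insertI insertI1)
  have small_uv: "small {u, v}" by (rule finite_small[OF infinite_UNIV]) simp
  \<comment> \<open>A function glued from two injections has fibres of at most two points, which
    gives \<open>N\<close> its test functions against both families.\<close>
  have two_fibres: "f \<in> N" if "inj_on f C" "inj_on f (- C)" for f C
  proof (rule bounded[OF small_uv])
    fix y
    have "inj_on (\<lambda>x. if x \<in> C then u else v) (f -` {y})"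
      using that uv by (auto simp: inj_on_def)
    then show "|f -` {y}| \<le>o |{u, v}|" by (rule card_of_ordLeqI) auto
  qed
  have N_M: "\<not> N \<subseteq> M_monoid |K|" if K: "index_set K" for K :: "'a set"
  proof -
    obtain e :: "'a \<Rightarrow> 'a" where e: "inj e" "|- range e| =o |K|"
      by (rule injection_corange[OF infinite_UNIV, of K])
    have "e \<in> N" by (rule two_fibres[of _ UNIV]) (use e(1) in simp_all)
    moreover have "e \<notin> M_monoid |K|"
      using e K not_ordLess_ordIso by (simp only: inj_mem_M_iff) blast
    ultimately show ?thesis by blast
  qed
  have N_G: "\<not> N \<subseteq> G_monoid |K|" if K: "index_set K" for K :: "'a set"
  proof -
    obtain q :: "'a \<Rightarrow> 'a" and C where q: "|C| =o |K|" "q ` (- C) = UNIV" "inj_on q (- C)" "inj_on q C"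
      by (rule surjection_omitting[OF infinite_UNIV, of K])
    have "q \<in> N" using q(4,3) by (rule two_fibres)
    then show ?thesis using omitting_not_mem_G[OF K q(1,2)] by blast
  qed
  obtain d :: "'a \<Rightarrow> 'a" where d: "surj d" "\<And>y. \<not> small (d -` {y})"
    using surjection_large_fibres[OF infinite_UNIV] by metis
  have M_N: "\<not> M_monoid |L| \<subseteq> N" if "index_set L" for L :: "'a set"
  proof -
    have "d \<notin> N" using d(2) not_small_UNIV by (intro large) simp
    then show ?thesis using surj_mem_M[OF that d(1)] by blast
  qed
  have G_N: "\<not> G_monoid |L| \<subseteq> N" for L :: "'a set"
  proof -
    obtain e :: "'a \<Rightarrow> 'a" where e: "inj e" "|- range e| =o |UNIV :: 'a set|"
      by (rule injection_corange[OF infinite_UNIV, of UNIV])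
    \<comment> \<open>The function \<open>e \<circ> d\<close> misses \<kappa> points, so it lies in
      every \<open>G_monoid |L|\<close>, yet all its fibres over \<open>range e\<close> have size
      \<kappa>.\<close>
    have "(e \<circ> d) -` {e y} = d -` {y}" for y using e(1) by (auto simp: inj_eq)
    then have "range e \<subseteq> {y. \<not> small ((e \<circ> d) -` {y})}" using d(2) by auto
    then have "e \<circ> d \<notin> N" using not_small_range[OF e(1)] small_subset by (intro large) blast
    moreover have "range (e \<circ> d) = range e" using d(1) by (simp only: image_comp[symmetric])
    then have "e \<circ> d \<in> G_monoid |L|"
      using ordLeq_ordIso_trans[OF card_of_mono1[OF subset_UNIV] ordIso_symmetric[OF e(2)]]
      by (intro corange_mem_G) simp
    ultimately show ?thesis by blast
  qed
  define F where "F = ?F"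
  have F: "F = {N} \<union> {G_monoid |L| | L :: 'a set. index_set L} \<union> {M_monoid |L| | L :: 'a set. index_set L}"
    by (simp only: F_def index_families)
  have cases: "P = N \<or> (\<exists>L :: 'a set. index_set L \<and> P = G_monoid |L| ) \<or>
      (\<exists>L :: 'a set. index_set L \<and> P = M_monoid |L| )" if "P \<in> F" for P
    using that unfolding F by blast
  have G_eq: "(G_monoid |K| :: ('a \<Rightarrow> 'a) set) = G_monoid |L|"
    if "index_set K" "index_set L" "(G_monoid |K| :: ('a \<Rightarrow> 'a) set) \<subseteq> G_monoid |L|" for K L :: "'a set"
    using G_subset_imp_ordIso[OF infinite_UNIV that(2,1,3)] by (rule G_monoid_cong)
  have M_eq: "(M_monoid |K| :: ('a \<Rightarrow> 'a) set) = M_monoid |L|"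
    if "index_set K" "index_set L" "(M_monoid |K| :: ('a \<Rightarrow> 'a) set) \<subseteq> M_monoid |L|" for K L :: "'a set"
    using M_subset_imp_ordIso[OF infinite_UNIV that(2,1,3)] by (rule M_monoid_cong)
  have antichain: "P = Q" if PQ: "P \<in> F" "Q \<in> F" "P \<subseteq> Q" for P Q
  proof -
    from cases[OF PQ(1)] consider "P = N"
      | K where "index_set (K :: 'a set)" "P = G_monoid |K|"
      | K where "index_set (K :: 'a set)" "P = M_monoid |K|"
      by metis
    then show ?thesis
    proof cases
      case 1
      then show ?thesis using cases[OF PQ(2)] PQ(3) N_G N_M by metis
    next
      case (2 K)
      then show ?thesis
        using cases[OF PQ(2)] PQ(3) G_N[of K] G_eq[of K] G_not_subset_M[OF infinite_UNIV, of _ K] by metis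
    next
      case (3 K)
      then show ?thesis
        using cases[OF PQ(2)] PQ(3) M_N[of K] M_eq[of K] M_not_subset_G[OF infinite_UNIV, of _ K] by metis
    qed
  qed
  have u: "index_set {u}" by (simp add: index_set_def)
  have proper: "permutation_monoid P" "P \<noteq> UNIV" if "P \<in> F" for P
  proof -
    from cases[OF that] show "permutation_monoid P"
      by (elim disjE exE conjE) (simp_all add: N permutation_monoid_G permutation_monoid_M)
    \<comment> \<open>By the antichain property, \<open>UNIV\<close> in \<open>F\<close> would make
      all members of \<open>F\<close> equal to it, although \<open>N\<close> lies in no
      \<open>G_monoid\<close>.\<close>
    have "UNIV \<notin> F"
    proof
      assume U: "UNIV \<in> F"
      have "N \<in> F" "G_monoid |{u}| \<in> F" unfolding F using u by blast+
      then have "N = UNIV" "G_monoid |{u}| = (UNIV :: ('a \<Rightarrow> 'a) set)"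
        using antichain[OF _ U] by simp_all
      then show False using G_N[of "{u}"] N_G[OF u] by simp
    qed
    with that show "P \<noteq> UNIV" by blast
  qed
  have cover': "\<exists>P\<in>F. H \<subseteq> P" if "permutation_monoid H" "H \<noteq> UNIV" for H
    using cover[OF that(1)] that(2) unfolding F by blast
  \<comment> \<open>Every proper submonoid containing the permutations lies in a member of
    \<open>F\<close>, and \<open>F\<close> is an antichain of proper ones, so its members are
    exactly the maximal ones.\<close>
  have "maximal_submonoid H (full_monoid :: ('a \<Rightarrow> 'a) monoid) \<and> {f. bij f} \<subseteq> H \<longleftrightarrow> H \<in> F" for H
  proof
    assume H: "maximal_submonoid H (full_monoid :: ('a \<Rightarrow> 'a) monoid) \<and> {f. bij f} \<subseteq> H"
    then have "permutation_monoid H" "H \<noteq> UNIV"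
      by (auto simp: maximal_submonoid_def permutation_monoid_iff full_monoid_def)
    then obtain P where P: "P \<in> F" "H \<subseteq> P" using cover' by blast
    then have "submonoid P (full_monoid :: ('a \<Rightarrow> 'a) monoid)"
      using proper(1) permutation_monoid_iff by blast
    with H P(2) have "P = H \<or> P = carrier (full_monoid :: ('a \<Rightarrow> 'a) monoid)"
      unfolding maximal_submonoid_def by blast
    then have "P = H" using proper(2)[OF P(1)] by (simp add: full_monoid_def)
    with P(1) show "H \<in> F" by simp
  next
    assume H: "H \<in> F"
    have "K = H \<or> K = UNIV" if "submonoid K (full_monoid :: ('a \<Rightarrow> 'a) monoid)" "H \<subseteq> K" for K
    proof (rule ccontr)
      assume K: "\<not> ?thesis"
      have "permutation_monoid K"
        using that proper(1)[OF H] unfolding permutation_monoid_iff by blast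
      then obtain P where P: "P \<in> F" "K \<subseteq> P" using cover' K by blast
      then have "H = P" using antichain[OF H] that(2) by simp
      with P(2) that(2) K show False by blast
    qed
    then show "maximal_submonoid H (full_monoid :: ('a \<Rightarrow> 'a) monoid) \<and> {f. bij f} \<subseteq> H"
      using proper[OF H] unfolding maximal_submonoid_def permutation_monoid_iff
      by (simp add: full_monoid_def)
  qed
  then show ?thesis unfolding F_def by blast
qed

section \<open>The regular and the singular case\<close>

lemma maximal_regular:
  assumes reg: "regularCard |UNIV :: 'a set|"
  shows "{H. maximal_submonoid H (full_monoid :: ('a \<Rightarrow> 'a) monoid) \<and> {f. bij f} \<subseteq> H} =
    {A_monoid} \<union> {G_monoid r | r. r \<in> (index_cardinals :: 'a rel set)}
        \<union> {M_monoid r | r. r \<in> (index_cardinals :: 'a rel set)}"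
proof (rule maximal_permutation_monoids)
  show "permutation_monoid (A_monoid :: ('a \<Rightarrow> 'a) set)" using reg by (rule permutation_monoid_A)
next
  fix f :: "'a \<Rightarrow> 'a" and S :: "'a set"
  assume "small S" "\<And>y. |f -` {y}| \<le>o |S|"
  then have "small (f -` {y})" for y using small_ordLeq by blast
  then show "f \<in> A_monoid" using finite_small[OF infinite_UNIV, of "{}"] by (simp add: mem_A_monoid)
next
  fix f :: "'a \<Rightarrow> 'a"
  assume "\<not> small {y. \<not> small (f -` {y})}"
  then show "f \<notin> A_monoid" by (simp add: mem_A_monoid)
next
  fix H :: "('a \<Rightarrow> 'a) set"
  assume H: "permutation_monoid H" "\<And>L :: 'a set. index_set L \<Longrightarrow> \<not> H \<subseteq> M_monoid |L|"
    "\<And>L :: 'a set. index_set L \<Longrightarrow> \<not> H \<subseteq> G_monoid |L|" and "\<not> H \<subseteq> A_monoid"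
  then obtain f where f: "f \<in> H" "f \<notin> A_monoid" by blast
  then have "\<not> small {y. \<not> small (f -` {y})}" by (simp add: mem_A_monoid)
  with infinite_UNIV H f(1) show "H = UNIV" by (rule large_fibres_imp_full)
qed

lemma maximal_singular:
  assumes sing: "\<not> regularCard |UNIV :: 'a set|"
  shows "{H. maximal_submonoid H (full_monoid :: ('a \<Rightarrow> 'a) monoid) \<and> {f. bij f} \<subseteq> H} =
    {A'_monoid} \<union> {G_monoid r | r. r \<in> (index_cardinals :: 'a rel set)}
        \<union> {M_monoid r | r. r \<in> (index_cardinals :: 'a rel set)}"
proof (rule maximal_permutation_monoids)
  show "permutation_monoid (A'_monoid :: ('a \<Rightarrow> 'a) set)" by (rule permutation_monoid_A')
next
  fix f :: "'a \<Rightarrow> 'a" and S :: "'a set"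
  assume "small S" "\<And>y. |f -` {y}| \<le>o |S|"
  then show "f \<in> A'_monoid" by (rule bounded_fibres_mem_A')
next
  fix f :: "'a \<Rightarrow> 'a"
  assume f: "\<not> small {y. \<not> small (f -` {y})}"
  \<comment> \<open>A fibre of size \<kappa> exceeds every small bound \<open>S\<close>.\<close>
  have "\<not> small {y. \<not> |f -` {y}| \<le>o |S|}" if "small S" for S :: "'a set"
  proof -
    have "{y. \<not> small (f -` {y})} \<subseteq> {y. \<not> |f -` {y}| \<le>o |S|}"
      using small_ordLeq[OF that] by blast
    then show ?thesis using f small_subset by blast
  qed
  then show "f \<notin> A'_monoid" unfolding mem_A'_monoid by blast
next
  fix H :: "('a \<Rightarrow> 'a) set"
  assume H: "permutation_monoid H" "\<And>L :: 'a set. index_set L \<Longrightarrow> \<not> H \<subseteq> M_monoid |L|"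
    "\<And>L :: 'a set. index_set L \<Longrightarrow> \<not> H \<subseteq> G_monoid |L|" and "\<not> H \<subseteq> A'_monoid"
  then obtain f where f: "f \<in> H" "f \<notin> A'_monoid" by blast
  then have "\<not> small {y. \<not> |f -` {y}| \<le>o |S|}" if "small S" for S :: "'a set"
    using that unfolding mem_A'_monoid by blast
  with infinite_UNIV H sing f(1) show "H = UNIV" by (rule singular_imp_full)
qed

end

theorem theorem4:
  assumes "infinite (UNIV :: 'a set)"
  shows "(regularCard |UNIV :: 'a set| \<longrightarrow>
            {H. maximal_submonoid H (full_monoid :: ('a \<Rightarrow> 'a) monoid) \<and> {f. bij f} \<subseteq> H} =
              {A_monoid} \<union> {G_monoid r | r. r \<in> (index_cardinals :: 'a rel set)}
                         \<union> {M_monoid r | r. r \<in> (index_cardinals :: 'a rel set)})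
       \<and> (\<not> regularCard |UNIV :: 'a set| \<longrightarrow>
            {H. maximal_submonoid H (full_monoid :: ('a \<Rightarrow> 'a) monoid) \<and> {f. bij f} \<subseteq> H} =
              {A'_monoid} \<union> {G_monoid r | r. r \<in> (index_cardinals :: 'a rel set)}
                          \<union> {M_monoid r | r. r \<in> (index_cardinals :: 'a rel set)})"
  using maximal_regular[OF assms] maximal_singular[OF assms] by blast

end
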